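(* Let $x_0$ be the largest real root of the polynomial $x^3-9(x-1)$ (so $x_0\approx 2.2268$). If $0\leqslant x<x_0$, then there are infinitely many matroids $M$ without loops and coloops for which $$T_M(x,0)\,T_M(0,x)<T_M(1,1)^2.$$
   Context: For a finite matroid $M$ on ground set $E$ with rank function $r$, the Tutte polynomial is $T_M(x,y)=\sum_{S\subseteq E}(x-1)^{r(E)-r(S)}(y-1)^{|S|-r(S)}$. A loop is an element $e$ with $r(\{e\})=0$; a coloop is an element contained in every basis of $M$. *)

theory Defs
  imports Complex_Main "HOL-Computational_Algebra.Polynomial"
begin

locale matroid =
  fixes E :: "'a set" and \<I> :: "'a set set"
  assumes finite_ground: "finite E"
    and indep_subset_ground: "\<And>X. X \<in> \<I> \<Longrightarrow> X \<subseteq> E"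
    and empty_indep: "{} \<in> \<I>"
    and indep_mono: "\<And>X Y. X \<in> \<I> \<Longrightarrow> Y \<subseteq> X \<Longrightarrow> Y \<in> \<I>"
    and augmentation: "\<And>X Y. X \<in> \<I> \<Longrightarrow> Y \<in> \<I> \<Longrightarrow> card X < card Y \<Longrightarrow> \<exists>e \<in> Y - X. insert e X \<in> \<I>"

definition matroid_rank :: "'a set set \<Rightarrow> 'a set \<Rightarrow> nat" where
  "matroid_rank \<I> S = Max (card ` {X \<in> \<I>. X \<subseteq> S})"

definition matroid_basis :: "'a set set \<Rightarrow> 'a set \<Rightarrow> bool" where
  "matroid_basis \<I> B \<longleftrightarrow> B \<in> \<I> \<and> (\<forall>X \<in> \<I>. B \<subseteq> X \<longrightarrow> X = B)"

definition matroid_loop :: "'a set \<Rightarrow> 'a set set \<Rightarrow> 'a \<Rightarrow> bool" where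
  "matroid_loop E \<I> e \<longleftrightarrow> e \<in> E \<and> matroid_rank \<I> {e} = 0"

definition matroid_coloop :: "'a set \<Rightarrow> 'a set set \<Rightarrow> 'a \<Rightarrow> bool" where
  "matroid_coloop E \<I> e \<longleftrightarrow> e \<in> E \<and> (\<forall>B. matroid_basis \<I> B \<longrightarrow> e \<in> B)"

text \<open>For a matroid both truncated subtractions below are exact; powers use \<open>0 ^ 0 = 1\<close>,
  as is needed to read the Tutte polynomial as a polynomial at \<open>x = 1\<close> or \<open>y = 1\<close>.\<close>

definition tutte :: "'a set \<Rightarrow> 'a set set \<Rightarrow> real \<Rightarrow> real \<Rightarrow> real" where
  "tutte E \<I> x y =
     (\<Sum>S \<in> Pow E. (x - 1) ^ (matroid_rank \<I> E - matroid_rank \<I> S) * (y - 1) ^ (card S - matroid_rank \<I> S))"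

definition matroid_isomorphic :: "'a set \<Rightarrow> 'a set set \<Rightarrow> 'b set \<Rightarrow> 'b set set \<Rightarrow> bool" where
  "matroid_isomorphic E \<I> E' \<I>' \<longleftrightarrow>
     (\<exists>f. bij_betw f E E' \<and> (\<forall>X. X \<subseteq> E \<longrightarrow> (X \<in> \<I> \<longleftrightarrow> f ` X \<in> \<I>')))"

text \<open>A matroid on a nonempty ground set has infinitely many relabelled copies, so matroids are
  counted as equivalence classes of this relation. Every finite matroid is isomorphic to one whose
  ground set is a set of natural numbers, so the instance at type \<open>nat\<close> captures all
  isomorphism classes.\<close>

definition matroid_iso_rel :: "(('a set \<times> 'a set set) \<times> ('a set \<times> 'a set set)) set" where
  "matroid_iso_rel = {((E, \<I>), (E', \<I>')).
     matroid E \<I> \<and> matroid E' \<I>' \<and> matroid_isomorphic E \<I> E' \<I>'}"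

lemma equiv_matroid_iso_rel: "equiv {(E, \<I>). matroid E \<I>} matroid_iso_rel"
proof (rule equivI)
  show "refl_on {(E, \<I>). matroid E \<I>} (matroid_iso_rel :: (('a set \<times> 'a set set) \<times> _) set)"
    by (auto simp: refl_on_def matroid_iso_rel_def matroid_isomorphic_def intro!: exI[of _ id])
  show "sym (matroid_iso_rel :: (('a set \<times> 'a set set) \<times> _) set)"
  proof -
    have "matroid_isomorphic E' J E I" if iso: "matroid_isomorphic E I E' J"
      for E E' :: "'a set" and I J
    proof -
      from iso obtain f where f: "bij_betw f E E'" "\<And>X. X \<subseteq> E \<Longrightarrow> (X \<in> I \<longleftrightarrow> f ` X \<in> J)"
        unfolding matroid_isomorphic_def by blast
      let ?g = "inv_into E f"
      have "Y \<in> J \<longleftrightarrow> ?g ` Y \<in> I" if "Y \<subseteq> E'" for Y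
      proof -
        have "f ` ?g ` Y = Y" "?g ` Y \<subseteq> E"
          using that f(1) by (auto simp: bij_betw_def image_inv_into_cancel inv_into_into subset_iff)
        then show ?thesis using f(2)[of "?g ` Y"] by simp
      qed
      then show ?thesis
        unfolding matroid_isomorphic_def using bij_betw_inv_into[OF f(1)] by blast
    qed
    then show ?thesis by (auto simp: matroid_iso_rel_def intro!: symI)
  qed
  show "trans (matroid_iso_rel :: (('a set \<times> 'a set set) \<times> _) set)"
  proof -
    have "matroid_isomorphic E I G K"
      if iso: "matroid_isomorphic E I F J" "matroid_isomorphic F J G K"
      for E F G :: "'a set" and I J K
    proof -
      from iso obtain f g where f: "bij_betw f E F" "\<And>X. X \<subseteq> E \<Longrightarrow> (X \<in> I \<longleftrightarrow> f ` X \<in> J)"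
        and g: "bij_betw g F G" "\<And>X. X \<subseteq> F \<Longrightarrow> (X \<in> J \<longleftrightarrow> g ` X \<in> K)"
        unfolding matroid_isomorphic_def by metis
      have "X \<in> I \<longleftrightarrow> (g \<circ> f) ` X \<in> K" if "X \<subseteq> E" for X
      proof -
        have "f ` X \<subseteq> F" using that f(1) by (auto simp: bij_betw_def)
        then show ?thesis using f(2)[OF that] g(2) by (simp add: image_comp)
      qed
      then show ?thesis
        unfolding matroid_isomorphic_def using bij_betw_trans[OF f(1) g(1)] by blast
    qed
    then show ?thesis unfolding matroid_iso_rel_def trans_def by blast
  qed
qed (auto simp: matroid_iso_rel_def)

definition x0 :: real where
  "x0 = Max {t :: real. t ^ 3 - 9 * (t - 1) = 0}"

lemma finite_x0_roots: "finite {t :: real. t ^ 3 - 9 * (t - 1) = 0}"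
proof -
  have "{t :: real. t ^ 3 - 9 * (t - 1) = 0} = {t. poly [:9, -9, 0, 1:] t = 0}"
    by (auto simp: power3_eq_cube algebra_simps)
  then show ?thesis using poly_roots_finite[of "[:9, -9, 0, 1 :: real:]"] by simp
qed

lemma x0_bounds: "2.2266 \<le> x0" "x0 < 2.2268"
proof -
  let ?p = "\<lambda>t :: real. t ^ 3 - 9 * (t - 1)"
  have "\<exists>t \<ge> 2.2266. t \<le> 2.2268 \<and> ?p t = 0"
    by (rule IVT') (auto intro!: continuous_intros simp: power3_eq_cube)
  then obtain t where t: "t \<ge> 2.2266" "?p t = 0" by blast
  then have "t \<le> x0" unfolding x0_def using finite_x0_roots by (intro Max_ge) auto
  then show "2.2266 \<le> x0" using t by simp
  have "x0 \<in> {t. ?p t = 0}" unfolding x0_def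
    using finite_x0_roots t by (intro Max_in) auto
  then have root: "?p x0 = 0" by simp
  have pos: "?p s > 0" if "s \<ge> 2.2268" for s
  proof -
    define u where "u = s - 2.2268"
    then have u: "u \<ge> 0" "s = u + 2.2268" using that by auto
    have "?p s = u ^ 3 + 3 * 2.2268 * u\<^sup>2 + (3 * 2.2268\<^sup>2 - 9) * u + (2.2268 ^ 3 - 9 * (2.2268 - 1))"
      unfolding u(2) by algebra
    moreover have "0 \<le> u ^ 3" "0 \<le> 3 * 2.2268 * u\<^sup>2" "0 \<le> (3 * 2.2268\<^sup>2 - 9) * u"
      using u(1) by (simp_all add: power2_eq_square)
    moreover have "(2.2268 :: real) ^ 3 - 9 * (2.2268 - 1) > 0"
      by (simp add: power3_eq_cube)
    ultimately show ?thesis by linarith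
  qed
  show "x0 < 2.2268"
  proof (rule ccontr)
    assume "\<not> x0 < 2.2268"
    then have "?p x0 > 0" by (intro pos) linarith
    then show False using root by linarith
  qed
qed

end

(* The matroids are the uniform matroids of rank 2m on 3m points with every point doubled. For a
   doubled uniform matroid of rank r on n points, grouping the subsets S by their set of underlying
   points gives
     T(x,y) = sum over a of (n choose a) (x-1)^(r-a) (y-1)^(a-r) (1+y)^a
   with truncated exponents. For x >= 2, comparison with full binomial expansions bounds
   T(x,0) T(0,x) by 4 (x^3/(x-1))^(3m), whereas T(1,1) = 4^m (3m choose 2m) is at least
   27^m / (2m+1). The exponential rates compare as x^3/(x-1) < 9, which is where x0 comes from.
   For x < 2 the bounds at 2 still apply, since then |x-1| <= 1. *)

theory Submission imports Defs "HOL-Real_Asymp.Real_Asymp" begin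

section \<open>Uniform matroids with parallel elements\<close>

text \<open>This is the partition matroid of the fibres of \<open>d\<close>, truncated at rank
  \<open>r\<close>. For \<open>0 < r\<close> it is a uniform matroid on the image of
  \<open>E\<close> under \<open>d\<close> with each point replaced by a class of parallel
  elements.\<close>

definition transversal_indep :: "('a \<Rightarrow> 'b) \<Rightarrow> nat \<Rightarrow> 'a set \<Rightarrow> 'a set set" where
  "transversal_indep d r E = {X. X \<subseteq> E \<and> inj_on d X \<and> card X \<le> r}"

text \<open>Augmentation reduces to images under \<open>d\<close>: an independent set has as many
  points as elements, so the larger set meets a fibre that the smaller one misses.\<close>

lemma matroid_transversal_indep:
  assumes "finite E"
  shows "matroid E (transversal_indep d r E)"
proof
  show "finite E" by fact
next
  fix X Y assume X: "X \<in> transversal_indep d r E" and Y: "Y \<in> transversal_indep d r E"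
    and lt: "card X < card Y"
  have fin: "finite X" "finite Y"
    using X Y assms by (auto simp: transversal_indep_def intro: finite_subset)
  have "card (d ` X) < card (d ` Y)"
    using X Y lt by (simp add: transversal_indep_def card_image)
  then have "\<not> d ` Y \<subseteq> d ` X"
    using fin by (meson card_mono finite_imageI leD)
  then obtain e where e: "e \<in> Y" "d e \<notin> d ` X" by auto
  moreover from e have "e \<notin> X" by auto
  ultimately have "insert e X \<in> transversal_indep d r E"
    using X Y lt fin by (auto simp: transversal_indep_def)
  then show "\<exists>e\<in>Y - X. insert e X \<in> transversal_indep d r E"
    using e \<open>e \<notin> X\<close> by auto
next
  fix X Y assume "X \<in> transversal_indep d r E" "Y \<subseteq> X"
  then show "Y \<in> transversal_indep d r E"
    unfolding transversal_indep_def
    by (auto intro: inj_on_subset dest: finite_subset[OF _ assms] order_trans[OF card_mono])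
qed (auto simp: transversal_indep_def)

lemma rank_transversal_indep:
  assumes "finite E" "S \<subseteq> E"
  shows "matroid_rank (transversal_indep d r E) S = min (card (d ` S)) r"
  unfolding matroid_rank_def
proof (rule Max_eqI)
  have finS: "finite S" using assms by (rule rev_finite_subset)
  then show "finite (card ` {X \<in> transversal_indep d r E. X \<subseteq> S})" by simp
  show "k \<le> min (card (d ` S)) r"
    if "k \<in> card ` {X \<in> transversal_indep d r E. X \<subseteq> S}" for k
  proof -
    from that obtain X where X: "k = card X" "X \<subseteq> S" "inj_on d X" "card X \<le> r"
      by (auto simp: transversal_indep_def)
    then have "card X \<le> card (d ` S)"
      using finS by (metis card_image card_mono finite_imageI image_mono)
    with X show ?thesis by simp
  qed
  obtain A where A: "A \<subseteq> d ` S" "card A = min (card (d ` S)) r"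
    by (meson min.cobounded1 obtain_subset_with_card_n)
  then obtain X where "X \<subseteq> S" "inj_on d X" "A = d ` X"
    by (auto simp: subset_image_inj)
  with A assms show "min (card (d ` S)) r \<in> card ` {X \<in> transversal_indep d r E. X \<subseteq> S}"
    by (intro image_eqI[of _ _ X]) (auto simp: transversal_indep_def card_image)
qed

lemma no_loop_transversal_indep:
  assumes "finite E" "0 < r"
  shows "\<not> matroid_loop E (transversal_indep d r E) e"
  using assms by (auto simp: matroid_loop_def rank_transversal_indep)

text \<open>At least \<open>r\<close> points other than \<open>d e\<close> remain, and lifting
  \<open>r\<close> of them gives a basis that avoids the whole fibre of \<open>e\<close>.\<close>

lemma no_coloop_transversal_indep:
  assumes "finite E" "r < card (d ` E)"
  shows "\<not> matroid_coloop E (transversal_indep d r E) e"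
proof
  assume e: "matroid_coloop E (transversal_indep d r E) e"
  then have "r \<le> card (d ` E - {d e})"
    using assms by (simp add: matroid_coloop_def card_Diff_singleton_if)
  then obtain A where A: "A \<subseteq> d ` E - {d e}" "card A = r"
    by (meson obtain_subset_with_card_n)
  then obtain X where X: "X \<subseteq> E" "inj_on d X" "A = d ` X"
    by (metis Diff_subset order_trans subset_image_inj)
  have "card X = r" using X A by (simp add: card_image)
  then have "matroid_basis (transversal_indep d r E) X"
    using X assms card_seteq[of _ X]
    by (auto simp: matroid_basis_def transversal_indep_def dest: finite_subset)
  then have "e \<in> X" using e by (simp add: matroid_coloop_def)
  then show False using A X by auto
qed

section \<open>The Tutte polynomial of a doubled uniform matroid\<close>

lemma sum_Pow_insert:
  fixes f :: "'a set \<Rightarrow> 'b :: comm_monoid_add"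
  assumes "finite A" "a \<notin> A"
  shows "(\<Sum>S\<in>Pow (insert a A). f S) = (\<Sum>S\<in>Pow A. f S + f (insert a S))"
proof -
  have "inj_on (insert a) (Pow A)"
    using assms(2) by (intro inj_onI) (metis Diff_insert_absorb PowD subsetD)
  moreover have "Pow A \<inter> insert a ` Pow A = {}" using assms(2) by auto
  ultimately show ?thesis
    using assms(1) by (simp add: Pow_insert sum.union_disjoint sum.reindex sum.distrib)
qed

text \<open>Pascal's rule in summed form: a new point is either absent, giving \<open>f a\<close>,
  or present, giving \<open>f (Suc a)\<close>.\<close>

lemma sum_choose_Suc:
  fixes f :: "nat \<Rightarrow> 'a :: comm_semiring_1"
  shows "(\<Sum>a\<le>Suc n. of_nat (Suc n choose a) * f a) = (\<Sum>a\<le>n. of_nat (n choose a) * (f a + f (Suc a)))"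
proof -
  have "(\<Sum>a\<le>Suc n. of_nat (Suc n choose a) * f a)
      = f 0 + (\<Sum>a\<le>n. of_nat (n choose Suc a) * f (Suc a)) + (\<Sum>a\<le>n. of_nat (n choose a) * f (Suc a))"
    by (subst sum.atMost_Suc_shift) (simp add: algebra_simps sum.distrib)
  also have "f 0 + (\<Sum>a\<le>n. of_nat (n choose Suc a) * f (Suc a))
      = (\<Sum>a\<le>Suc n. of_nat (n choose a) * f a)"
    by (subst sum.atMost_Suc_shift) simp
  also have "\<dots> = (\<Sum>a\<le>n. of_nat (n choose a) * f a)" by (simp add: binomial_eq_0)
  finally show ?thesis by (simp only: distrib_left sum.distrib)
qed

text \<open>A point below \<open>S\<close> is represented by one of its two copies or by both; the
  pair has one surplus element, so each point contributes the factor \<open>2 + z\<close>. Adding a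
  point replaces \<open>f a\<close> by \<open>f a + (2 + z) * f (Suc a)\<close>, which is why the
  induction is over arbitrary \<open>f\<close>.\<close>

lemma sum_doubled_subsets:
  fixes z :: real
  shows "(\<Sum>S\<in>Pow {..<2 * n}. f (card ((\<lambda>i. i div 2) ` S)) * z ^ (card S - card ((\<lambda>i. i div 2) ` S)))
    = (\<Sum>a\<le>n. real (n choose a) * (f a * (2 + z) ^ a))"
proof (induction n arbitrary: f)
  case 0
  show ?case by simp
next
  case (Suc n)
  define c where "c = (\<lambda>S. card ((\<lambda>i::nat. i div 2) ` S))"
  have set_eq: "{..<2 * Suc n} = insert (2 * n) (insert (2 * n + 1) {..<2 * n})" by auto
  have step: "c (insert (2 * n) S) = Suc (c S)" "c (insert (2 * n + 1) S) = Suc (c S)"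
      "c (insert (2 * n) (insert (2 * n + 1) S)) = Suc (c S)"
      "card (insert (2 * n) S) = Suc (card S)" "card (insert (2 * n + 1) S) = Suc (card S)"
      "card (insert (2 * n) (insert (2 * n + 1) S)) = Suc (Suc (card S))"
      "c S \<le> card S"
    if "S \<in> Pow {..<2 * n}" for S
  proof -
    have fin: "finite S" using that finite_subset by auto
    have new: "n \<notin> (\<lambda>i. i div 2) ` S" using that by auto
    have notin: "2 * n \<notin> S" "2 * n + 1 \<notin> S" using that by auto
    show "c (insert (2 * n) S) = Suc (c S)" "c (insert (2 * n + 1) S) = Suc (c S)"
      "c (insert (2 * n) (insert (2 * n + 1) S)) = Suc (c S)"
      using fin new by (simp_all add: c_def)
    show "card (insert (2 * n) S) = Suc (card S)" "card (insert (2 * n + 1) S) = Suc (card S)"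
      "card (insert (2 * n) (insert (2 * n + 1) S)) = Suc (Suc (card S))"
      using fin notin by simp_all
    show "c S \<le> card S" using fin by (simp add: c_def card_image_le)
  qed
  have "(\<Sum>S\<in>Pow {..<2 * Suc n}. f (c S) * z ^ (card S - c S))
      = (\<Sum>S\<in>Pow {..<2 * n}. (f (c S) + (2 + z) * f (Suc (c S))) * z ^ (card S - c S))"
    unfolding set_eq
  proof (subst sum_Pow_insert, simp, simp, subst sum_Pow_insert, simp, simp, rule sum.cong[OF refl])
    fix S assume "S \<in> Pow {..<2 * n}"
    note S = step[OF this]
    \<comment> \<open>The full pair adds two elements but one point. The bound
      \<open>c S \<le> card S\<close> keeps the truncated subtraction exact, so precisely one extra
      factor \<open>z\<close> appears.\<close>
    have "Suc (Suc (card S)) - Suc (c S) = Suc (card S - c S)" using S(7) by simp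
    then show "f (c S) * z ^ (card S - c S)
        + f (c (insert (2 * n) S)) * z ^ (card (insert (2 * n) S) - c (insert (2 * n) S))
        + (f (c (insert (2 * n + 1) S)) * z ^ (card (insert (2 * n + 1) S) - c (insert (2 * n + 1) S))
        + f (c (insert (2 * n) (insert (2 * n + 1) S)))
          * z ^ (card (insert (2 * n) (insert (2 * n + 1) S)) - c (insert (2 * n) (insert (2 * n + 1) S))))
        = (f (c S) + (2 + z) * f (Suc (c S))) * z ^ (card S - c S)"
      unfolding S by (simp add: algebra_simps)
  qed
  also have "\<dots> = (\<Sum>a\<le>n. real (n choose a) * ((f a + (2 + z) * f (Suc a)) * (2 + z) ^ a))"
    using Suc.IH[of "\<lambda>a. f a + (2 + z) * f (Suc a)"] by (simp add: c_def)
  also have "\<dots> = (\<Sum>a\<le>Suc n. real (Suc n choose a) * (f a * (2 + z) ^ a))"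
    by (subst sum_choose_Suc) (simp add: algebra_simps)
  finally show ?case by (simp add: c_def)
qed

abbreviation doubled_uniform :: "nat \<Rightarrow> nat \<Rightarrow> nat set set" where
  "doubled_uniform n r \<equiv> transversal_indep (\<lambda>i. i div 2) r {..<2 * n}"

lemma image_div_2_lessThan: "(\<lambda>i::nat. i div 2) ` {..<2 * n} = {..<n}"
proof (intro equalityI subsetI)
  show "i \<in> (\<lambda>i. i div 2) ` {..<2 * n}" if "i \<in> {..<n}" for i
    using that by (intro image_eqI[of _ _ "2 * i"]) auto
qed auto

lemma tutte_doubled_uniform:
  assumes "r \<le> n"
  shows "tutte {..<2 * n} (doubled_uniform n r) x y
    = (\<Sum>a\<le>n. real (n choose a) * ((x - 1) ^ (r - a) * (y - 1) ^ (a - r) * (1 + y) ^ a))"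
proof -
  define c where "c = (\<lambda>S. card ((\<lambda>i::nat. i div 2) ` S))"
  have summand: "(x - 1) ^ (min n r - min (c S) r) * (y - 1) ^ (card S - min (c S) r)
      = (x - 1) ^ (r - c S) * (y - 1) ^ (c S - r) * (y - 1) ^ (card S - c S)"
    if "S \<in> Pow {..<2 * n}" for S
  proof -
    have "c S \<le> card S"
      using that by (auto simp: c_def intro!: card_image_le finite_subset[of S])
    \<comment> \<open>The nullity splits into the surplus of points over the rank and the surplus of
      elements over points; only the second depends on more than \<open>c S\<close>.\<close>
    then have "card S - min (c S) r = (c S - r) + (card S - c S)" by auto
    moreover have "min n r - min (c S) r = r - c S" using assms by auto
    ultimately show ?thesis by (simp add: power_add)
  qed
  have "tutte {..<2 * n} (doubled_uniform n r) x y
      = (\<Sum>S\<in>Pow {..<2 * n}. (x - 1) ^ (min n r - min (c S) r) * (y - 1) ^ (card S - min (c S) r))"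
    unfolding tutte_def
    by (intro sum.cong refl) (simp add: rank_transversal_indep image_div_2_lessThan c_def)
  also have "\<dots> = (\<Sum>S\<in>Pow {..<2 * n}.
      (x - 1) ^ (r - c S) * (y - 1) ^ (c S - r) * (y - 1) ^ (card S - c S))"
    using summand by (rule sum.cong[OF refl])
  also have "\<dots> = (\<Sum>a\<le>n. real (n choose a) * ((x - 1) ^ (r - a) * (y - 1) ^ (a - r) * (2 + (y - 1)) ^ a))"
    unfolding c_def by (rule sum_doubled_subsets)
  finally show ?thesis by simp
qed

lemma abs_tutte_doubled_uniform_le:
  assumes "r \<le> n"
    and "\<And>a. a \<le> n \<Longrightarrow> \<bar>(x - 1) ^ (r - a) * (y - 1) ^ (a - r) * (1 + y) ^ a\<bar> \<le> g a"
  shows "\<bar>tutte {..<2 * n} (doubled_uniform n r) x y\<bar> \<le> (\<Sum>a\<le>n. real (n choose a) * g a)"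
  unfolding tutte_doubled_uniform[OF assms(1)]
proof (rule order_trans[OF sum_abs], rule sum_mono)
  fix a assume "a \<in> {..n}"
  then show "\<bar>real (n choose a) * ((x - 1) ^ (r - a) * (y - 1) ^ (a - r) * (1 + y) ^ a)\<bar>
      \<le> real (n choose a) * g a"
    unfolding abs_mult[of "real (n choose a)"] abs_of_nat using assms(2) by (intro mult_left_mono) auto
qed

text \<open>Positive powers of 0 vanish, so only \<open>a = r\<close> survives: bases are
  \<open>r\<close> distinct points with two choices of element at each.\<close>

lemma tutte_doubled_uniform_1_1:
  assumes "r \<le> n"
  shows "tutte {..<2 * n} (doubled_uniform n r) 1 1 = 2 ^ r * real (n choose r)"
proof -
  have "tutte {..<2 * n} (doubled_uniform n r) 1 1
      = (\<Sum>a\<le>n. if a = r then real (n choose a) * 2 ^ a else 0)"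
    unfolding tutte_doubled_uniform[OF assms] by (intro sum.cong refl) (auto simp: power_0_left)
  then show ?thesis using assms by simp
qed

section \<open>Bounds for rank 2m on 3m points\<close>

lemma sum_choose_power:
  fixes s :: "'a :: comm_semiring_1"
  shows "(\<Sum>a\<le>n. of_nat (n choose a) * s ^ a) = (1 + s) ^ n"
  using binomial_ring[of s 1 n] by (simp add: add.commute)

text \<open>Each summand is majorised by two terms that the binomial theorem sums: the first is
  exact for \<open>a \<le> 2 * m\<close> once \<open>u\<close> replaces
  \<open>\<bar>x - 1\<bar>\<close>, and the constant 1 covers larger \<open>a\<close>. The parameter
  \<open>u\<close> also allows \<open>x < 2\<close>, with \<open>u = 1\<close>.\<close>

lemma abs_tutte_x_0_le:
  assumes "1 \<le> u" "\<bar>x - 1\<bar> \<le> u"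
  shows "\<bar>tutte {..<2 * (3 * m)} (doubled_uniform (3 * m) (2 * m)) x 0\<bar> \<le> 2 * ((1 + u) ^ 3 / u) ^ m"
proof -
  have summand: "\<bar>(x - 1) ^ (2 * m - a) * (0 - 1) ^ (a - 2 * m) * (1 + 0) ^ a\<bar> \<le> u ^ (3 * m - a) / u ^ m + 1"
    if "a \<le> 3 * m" for a
  proof -
    have "\<bar>x - 1\<bar> ^ (2 * m - a) \<le> u ^ (2 * m - a)" using assms by (intro power_mono) auto
    also have "\<dots> \<le> u ^ (3 * m - a) / u ^ m + 1"
    proof (cases "a \<le> 2 * m")
      case True
      then have "u ^ (3 * m - a) = u ^ (2 * m - a) * u ^ m" by (simp flip: power_add)
      then show ?thesis using assms by simp
    qed (use assms in simp)
    finally show ?thesis by (simp add: abs_mult power_abs)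
  qed
  have "\<bar>tutte {..<2 * (3 * m)} (doubled_uniform (3 * m) (2 * m)) x 0\<bar>
      \<le> (\<Sum>a\<le>3 * m. real (3 * m choose a) * (u ^ (3 * m - a) / u ^ m + 1))"
    using summand by (intro abs_tutte_doubled_uniform_le) auto
  also have "\<dots> = (\<Sum>a\<le>3 * m. real (3 * m choose a) * u ^ (3 * m - a)) / u ^ m
      + (\<Sum>a\<le>3 * m. real (3 * m choose a) * 1 ^ a)"
    by (simp add: algebra_simps sum.distrib sum_divide_distrib)
  also have "\<dots> = (1 + u) ^ (3 * m) / u ^ m + 2 ^ (3 * m)"
    using binomial_ring[of 1 u "3 * m"] by (simp only: sum_choose_power) simp
  also have "\<dots> = ((1 + u) ^ 3 / u) ^ m + 8 ^ m"
    by (simp add: power_mult power_divide)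
  also have "(8::real) ^ m \<le> ((1 + u) ^ 3 / u) ^ m"
  proof (intro power_mono)
    \<comment> \<open>The two rates coincide at \<open>u = 1\<close>, so \<open>u - 1\<close>
      factors out, and the cofactor is positive for \<open>u \<ge> 1\<close>.\<close>
    have "(1 + u) ^ 3 - 8 * u = (u - 1) * (u\<^sup>2 + 4 * u - 1)" by algebra
    moreover have "0 \<le> (u - 1) * (u\<^sup>2 + 4 * u - 1)"
      using assms(1) zero_le_power2[of u] by (intro mult_nonneg_nonneg; linarith)
    ultimately have "8 * u \<le> (1 + u) ^ 3" by linarith
    then show "8 \<le> (1 + u) ^ 3 / u" using assms by (simp add: field_simps)
  qed simp
  finally show ?thesis by simp
qed

text \<open>Again one term is exact on one side of the rank, here \<open>a \<ge> 2 * m\<close>, and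
  its binomial sum collapses through \<open>1 + u * (2 + u) = (1 + u)\<^sup>2\<close>. The other
  term covers \<open>a < 2 * m\<close>.\<close>

lemma abs_tutte_0_x_le:
  assumes "1 \<le> u" "\<bar>x - 1\<bar> \<le> u" "0 \<le> x"
  shows "\<bar>tutte {..<2 * (3 * m)} (doubled_uniform (3 * m) (2 * m)) 0 x\<bar>
    \<le> 2 * (((1 + u) ^ 3 / u)\<^sup>2) ^ m"
proof -
  have summand: "\<bar>(0 - 1) ^ (2 * m - a) * (x - 1) ^ (a - 2 * m) * (1 + x) ^ a\<bar>
      \<le> (u * (2 + u)) ^ a / u ^ (2 * m) + ((2 + u) / 2) ^ (2 * m) * 2 ^ a" for a
  proof -
    have "\<bar>x - 1\<bar> ^ (a - 2 * m) * (1 + x) ^ a \<le> u ^ (a - 2 * m) * (2 + u) ^ a"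
      using assms by (intro mult_mono power_mono) auto
    also have "\<dots> \<le> (u * (2 + u)) ^ a / u ^ (2 * m) + ((2 + u) / 2) ^ (2 * m) * 2 ^ a"
    proof (cases "2 * m \<le> a")
      case True
      then have "u ^ a = u ^ (a - 2 * m) * u ^ (2 * m)" by (simp flip: power_add)
      then show ?thesis using assms by (simp add: power_mult_distrib)
    next
      case False
      \<comment> \<open>A Chernoff-type tilt: the base 2 minimises
        \<open>(1 + s) ^ 3 / s\<^sup>2\<close>, the rate that a general base \<open>s\<close> would
        give, and puts the bulk of the binomial sum at \<open>a = 2 * m\<close>.\<close>
      have "(2 + u) ^ a = ((2 + u) / 2) ^ a * 2 ^ a" by (simp add: power_divide)
      also have "\<dots> \<le> ((2 + u) / 2) ^ (2 * m) * 2 ^ a"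
        using False assms by (intro mult_right_mono power_increasing) auto
      finally show ?thesis using False assms by (simp add: add_increasing)
    qed
    finally show ?thesis using assms by (simp add: abs_mult power_abs)
  qed
  have "\<bar>tutte {..<2 * (3 * m)} (doubled_uniform (3 * m) (2 * m)) 0 x\<bar>
      \<le> (\<Sum>a\<le>3 * m. real (3 * m choose a) *
          ((u * (2 + u)) ^ a / u ^ (2 * m) + ((2 + u) / 2) ^ (2 * m) * 2 ^ a))"
    using summand by (intro abs_tutte_doubled_uniform_le) auto
  also have "\<dots> = (\<Sum>a\<le>3 * m. real (3 * m choose a) * (u * (2 + u)) ^ a) / u ^ (2 * m)
      + ((2 + u) / 2) ^ (2 * m) * (\<Sum>a\<le>3 * m. real (3 * m choose a) * 2 ^ a)"
    by (simp add: distrib_left sum.distrib sum_divide_distrib sum_distrib_left mult_ac)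
  also have "\<dots> = (1 + u * (2 + u)) ^ (3 * m) / u ^ (2 * m) + ((2 + u) / 2) ^ (2 * m) * (1 + 2) ^ (3 * m)"
    by (simp only: sum_choose_power)
  also have "1 + u * (2 + u) = (1 + u)\<^sup>2" by algebra
  also have "((1 + u)\<^sup>2) ^ (3 * m) / u ^ (2 * m) = (((1 + u) ^ 3 / u)\<^sup>2) ^ m"
    by (simp add: power_divide mult.assoc flip: power_mult)
  also have "((2 + u) / 2) ^ (2 * m) * (1 + 2) ^ (3 * m) = (27 / 4 * (2 + u)\<^sup>2) ^ m"
    by (simp add: power_mult power_divide power_mult_distrib)
  also have "(27 / 4 * (2 + u)\<^sup>2) ^ m \<le> (((1 + u) ^ 3 / u)\<^sup>2) ^ m"
  proof (intro power_mono)
    \<comment> \<open>AM-GM in the form \<open>27 (y - 1)\<^sup>2 \<le> 4 y ^ 3\<close> for \<open>y = (1 + u)\<^sup>2\<close>, with equality at \<open>y = 3\<close>\<close>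
    have "4 * ((1 + u) ^ 3)\<^sup>2 - 27 * (2 + u)\<^sup>2 * u\<^sup>2 = ((1 + u)\<^sup>2 - 3)\<^sup>2 * (4 * (1 + u)\<^sup>2 - 3)"
      by algebra
    moreover have "0 \<le> ((1 + u)\<^sup>2 - 3)\<^sup>2 * (4 * (1 + u)\<^sup>2 - 3)"
    proof (rule mult_nonneg_nonneg)
      show "0 \<le> 4 * (1 + u)\<^sup>2 - 3"
        using assms(1) one_le_power[of "1 + u" 2] by linarith
    qed simp
    ultimately have "27 * (2 + u)\<^sup>2 * u\<^sup>2 \<le> 4 * ((1 + u) ^ 3)\<^sup>2" by linarith
    then show "27 / 4 * (2 + u)\<^sup>2 \<le> ((1 + u) ^ 3 / u)\<^sup>2"
      using assms by (simp add: power_divide field_simps)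
  qed simp
  finally show ?thesis by simp
qed

text \<open>Induction through the ratio of consecutive binomial coefficients, which tends to 27/4;
  the factor \<open>2 * m + 1\<close> absorbs the polynomial loss.\<close>

lemma choose_3m_2m_ge: "27 ^ m \<le> (2 * m + 1) * 4 ^ m * (3 * m choose 2 * m)"
proof (induction m)
  case (Suc m)
  let ?C = "\<lambda>m. real (3 * m choose 2 * m)"
  have fact_form: "?C k = fact (3 * k) / (fact (2 * k) * fact k)" for k
    by (subst binomial_fact) auto
  define M where "M = real m"
  have M: "0 \<le> M" by (simp add: M_def)
  define q where "q = (2 * M + 2) * (2 * M + 1)"
  have nonzero: "q \<noteq> 0" "M + 1 \<noteq> 0" using M by (auto simp: q_def)
  have "3 * Suc m = Suc (Suc (Suc (3 * m)))" "2 * Suc m = Suc (Suc (2 * m))" by auto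
  then have fact_Suc_mult:
      \<comment> \<open>The factor \<open>3 * M + 3\<close> is written as \<open>3 * (M + 1)\<close>
        so that \<open>M + 1\<close> cancels against \<open>fact (Suc m)\<close>.\<close>
      "fact (3 * Suc m) = 3 * (3 * M + 2) * (3 * M + 1) * (M + 1) * fact (3 * m)"
      "fact (2 * Suc m) = q * fact (2 * m)" "fact (Suc m) = (M + 1) * fact m"
    by (simp_all only: fact_Suc of_nat_Suc of_nat_mult of_nat_numeral q_def M_def)
      (simp_all add: algebra_simps)
  have "?C (Suc m) * q = 3 * (3 * M + 2) * (3 * M + 1) * ?C m"
    unfolding fact_form fact_Suc_mult using nonzero by (simp add: divide_simps)
  then have rec: "?C (Suc m) * ((2 * M + 2) * (2 * M + 1)) = 3 * (3 * M + 2) * (3 * M + 1) * ?C m"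
    by (simp only: q_def)
  \<comment> \<open>After expansion the cubic coefficients agree and every lower one is larger on
    the right.\<close>
  have "27 * (2 * M + 1) * ((2 * M + 2) * (2 * M + 1)) \<le> (2 * M + 3) * 4 * (3 * (3 * M + 2) * (3 * M + 1))"
    using M by (simp add: algebra_simps add_mono mult_mono power3_eq_cube)
  then have "27 * (2 * M + 1) * ((2 * M + 2) * (2 * M + 1)) * (4 ^ m * ?C m)
      \<le> (2 * M + 3) * 4 * (3 * (3 * M + 2) * (3 * M + 1)) * (4 ^ m * ?C m)"
    by (intro mult_right_mono) auto
  also have "\<dots> = (2 * M + 3) * 4 ^ Suc m * (3 * (3 * M + 2) * (3 * M + 1) * ?C m)"
    by (simp add: mult_ac)
  also have "\<dots> = (2 * M + 3) * 4 ^ Suc m * ?C (Suc m) * ((2 * M + 2) * (2 * M + 1))"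
    using rec by (simp only: mult_ac)
  finally have "27 * ((2 * M + 1) * 4 ^ m * ?C m) * ((2 * M + 2) * (2 * M + 1))
      \<le> (2 * M + 3) * 4 ^ Suc m * ?C (Suc m) * ((2 * M + 2) * (2 * M + 1))"
    by (simp only: mult_ac)
  then have le: "27 * ((2 * M + 1) * 4 ^ m * ?C m) \<le> (2 * M + 3) * 4 ^ Suc m * ?C (Suc m)"
    by (rule mult_right_le_imp_le) (use M in auto)
  have "real (27 ^ m) \<le> real ((2 * m + 1) * 4 ^ m * (3 * m choose 2 * m))"
    using Suc.IH by (simp only: of_nat_le_iff)
  then have "real (27 ^ Suc m) \<le> 27 * ((2 * M + 1) * 4 ^ m * ?C m)"
    by (simp add: M_def algebra_simps)
  also note le
  also have "(2 * M + 3) * 4 ^ Suc m * ?C (Suc m)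
      = real ((2 * Suc m + 1) * 4 ^ Suc m * (3 * Suc m choose 2 * Suc m))"
    unfolding M_def of_nat_mult by simp
  finally show ?case by (simp only: of_nat_le_iff)
qed simp

section \<open>Comparison of the exponential rates below \<open>x0\<close>\<close>

lemma below_x0:
  assumes "2 \<le> y" "y < x0"
  shows "y ^ 3 < 9 * (y - 1)"
proof -
  \<comment> \<open>The cubic changes sign between 2 and 3; the root found there makes the set under
    \<open>Max\<close> nonempty, so \<open>x0\<close> is itself a root.\<close>
  have "\<exists>t\<ge>2. t \<le> 3 \<and> t ^ 3 - 9 * (t - 1) = (0::real)"
    by (rule IVT') (auto intro!: continuous_intros)
  then have "x0 \<in> {t. t ^ 3 - 9 * (t - 1) = 0}"
    unfolding x0_def using finite_x0_roots by (intro Max_in) auto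
  \<comment> \<open>Subtracting the equation for \<open>x0\<close> makes \<open>x0 - y\<close> a
    factor; the cofactor is at least 12 - 9 because both numbers are at least 2.\<close>
  then have "9 * (y - 1) - y ^ 3 = (x0 - y) * (x0\<^sup>2 + x0 * y + y\<^sup>2 - 9)"
    by simp algebra
  moreover have "2 * 2 \<le> x0 * x0" "2 * 2 \<le> x0 * y" "2 * 2 \<le> y * y"
    using assms by (intro mult_mono; linarith)+
  then have "0 < (x0 - y) * (x0\<^sup>2 + x0 * y + y\<^sup>2 - 9)"
    using assms by (intro mult_pos_pos) (auto simp: power2_eq_square)
  ultimately show ?thesis by linarith
qed

lemma eventually_tutte_product_less:
  assumes "0 \<le> x" "x < x0"
  shows "\<forall>\<^sub>F m in sequentially.
    tutte {..<2 * (3 * m)} (doubled_uniform (3 * m) (2 * m)) x 0 *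
    tutte {..<2 * (3 * m)} (doubled_uniform (3 * m) (2 * m)) 0 x <
    (tutte {..<2 * (3 * m)} (doubled_uniform (3 * m) (2 * m)) 1 1)\<^sup>2"
proof -
  \<comment> \<open>Then \<open>1 + u\<close> is the maximum of 2 and \<open>x\<close>, which still
    lies below \<open>x0\<close> because \<open>x0\<close> exceeds 2.\<close>
  define u where "u = max 1 (x - 1)"
  have u: "1 \<le> u" "\<bar>x - 1\<bar> \<le> u" using assms by (auto simp: u_def)
  define w where "w = (1 + u) ^ 3 / u"
  have "1 + u < x0" using assms x0_bounds(1) by (auto simp: u_def max_def)
  then have "(1 + u) ^ 3 < 9 * u" using below_x0[of "1 + u"] u by simp
  then have w: "0 < w" "w < 9" using u by (auto simp: w_def field_simps)
  \<comment> \<open>The product of the upper bounds is \<open>4 * (w ^ 3) ^ m\<close>, while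
    \<open>(T(1,1))\<^sup>2\<close> grows like 729 to the \<open>m\<close> up to a polynomial
    factor. As 729 is both the cube of 9 and the square of 27, \<open>w < 9\<close> gives
    \<open>q < 1\<close>.\<close>
  define q where "q = w ^ 3 / 729"
  have "w ^ 3 < 9 ^ 3" using w by (intro power_strict_mono) auto
  then have q: "0 < q" "q < 1" using w by (auto simp: q_def)
  have "(\<lambda>m. 4 * (2 * real m + 1)\<^sup>2 * q ^ m) \<longlonglongrightarrow> 0" using q by real_asymp
  then have "\<forall>\<^sub>F m in sequentially. 4 * (2 * real m + 1)\<^sup>2 * q ^ m < 1"
    by (rule order_tendstoD) simp
  then show ?thesis
  proof eventually_elim
    case (elim m)
    let ?T = "tutte {..<2 * (3 * m)} (doubled_uniform (3 * m) (2 * m))"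
    have T11: "?T 1 1 = 4 ^ m * real (3 * m choose 2 * m)"
      by (subst tutte_doubled_uniform_1_1) (auto simp: power_mult)
    have "?T x 0 * ?T 0 x \<le> \<bar>?T x 0\<bar> * \<bar>?T 0 x\<bar>" by (simp flip: abs_mult)
    also have "\<dots> \<le> (2 * w ^ m) * (2 * (w\<^sup>2) ^ m)"
      unfolding w_def using u assms w
      by (intro mult_mono abs_tutte_x_0_le abs_tutte_0_x_le) auto
    also have "\<dots> = 4 * q ^ m * 729 ^ m"
      by (simp add: q_def power_divide power3_eq_cube power2_eq_square power_mult_distrib)
    finally have upper: "?T x 0 * ?T 0 x \<le> 4 * q ^ m * 729 ^ m" .
    have "real (27 ^ m) \<le> real ((2 * m + 1) * 4 ^ m * (3 * m choose 2 * m))"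
      using choose_3m_2m_ge[of m] by (simp only: of_nat_le_iff)
    then have "27 ^ m \<le> (2 * real m + 1) * ?T 1 1" unfolding T11 by (simp add: algebra_simps)
    then have "(27 ^ m)\<^sup>2 \<le> ((2 * real m + 1) * ?T 1 1)\<^sup>2" by (rule power_mono) simp
    also have "((27::real) ^ m)\<^sup>2 = 729 ^ m" by (simp add: power2_eq_square flip: power_mult_distrib)
    finally have lower: "729 ^ m \<le> (2 * real m + 1)\<^sup>2 * (?T 1 1)\<^sup>2" by (simp add: power_mult_distrib)
    have "(2 * real m + 1)\<^sup>2 * (4 * q ^ m * 729 ^ m) < 729 ^ m"
      using mult_strict_right_mono[OF elim, of "729 ^ m"] by (simp add: mult_ac)
    also note lower
    finally have "4 * q ^ m * 729 ^ m < (?T 1 1)\<^sup>2"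
      by (rule mult_left_less_imp_less) simp
    with upper show ?case by linarith
  qed
qed

section \<open>Isomorphism classes\<close>

text \<open>The size of the ground set is an isomorphism invariant, so it can be read off any
  representative of a class; finitely many classes would yield finitely many sizes.\<close>

lemma infinite_iso_classes:
  assumes card: "infinite ((card \<circ> fst) ` \<M>)" and sub: "\<M> \<subseteq> {(E, \<I>). matroid E \<I>}"
  shows "infinite (\<M> // matroid_iso_rel)"
proof
  assume fin: "finite (\<M> // matroid_iso_rel)"
  have same: "card (fst M) = card (fst N)" if "(M, N) \<in> matroid_iso_rel"
    for M N :: "'a set \<times> 'a set set"
    using that by (auto simp: matroid_iso_rel_def matroid_isomorphic_def bij_betw_same_card)
  have "(card \<circ> fst) ` \<M> \<subseteq> (\<lambda>C. card (fst (SOME M. M \<in> C))) ` (\<M> // matroid_iso_rel)"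
  proof
    fix k assume "k \<in> (card \<circ> fst) ` \<M>"
    then obtain M where M: "M \<in> \<M>" "k = card (fst M)" by auto
    have "M \<in> matroid_iso_rel `` {M}"
      using M sub equiv_class_self[OF equiv_matroid_iso_rel] by blast
    then have "(SOME N. N \<in> matroid_iso_rel `` {M}) \<in> matroid_iso_rel `` {M}"
      by (rule someI)
    then have "k = card (fst (SOME N. N \<in> matroid_iso_rel `` {M}))"
      using same M by auto
    then show "k \<in> (\<lambda>C. card (fst (SOME M. M \<in> C))) ` (\<M> // matroid_iso_rel)"
      using M by (blast intro: quotientI)
  qed
  with fin card show False by (meson finite_imageI finite_subset)
qed

theorem theorem1p2:
  fixes x :: real
  assumes "0 \<le> x" and "x < x0"
  shows "infinite ({(E :: nat set, \<I>). matroid E \<I>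
            \<and> (\<forall>e. \<not> matroid_loop E \<I> e) \<and> (\<forall>e. \<not> matroid_coloop E \<I> e)
            \<and> tutte E \<I> x 0 * tutte E \<I> 0 x < (tutte E \<I> 1 1)\<^sup>2} // matroid_iso_rel)"
    (is "infinite (?\<M> // _)")
proof (rule infinite_iso_classes)
  show "?\<M> \<subseteq> {(E, \<I>). matroid E \<I>}" by auto
  \<comment> \<open>Positivity of \<open>m\<close> gives \<open>0 < 2 * m < 3 * m\<close>: the first
    inequality excludes loops, the second coloops.\<close>
  have "\<forall>\<^sub>F m in sequentially. 0 < m \<and> ({..<2 * (3 * m)}, doubled_uniform (3 * m) (2 * m)) \<in> ?\<M>"
    using eventually_tutte_product_less[OF assms] eventually_gt_at_top[of 0]
  proof eventually_elim
    case (elim m)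
    then show ?case
      using no_loop_transversal_indep[of "{..<2 * (3 * m)}" "2 * m" "\<lambda>i. i div 2"]
        no_coloop_transversal_indep[of "{..<2 * (3 * m)}" "2 * m" "\<lambda>i. i div 2"]
      by (simp add: matroid_transversal_indep image_div_2_lessThan[of "3 * m", simplified])
  qed
  then obtain m0 where m0: "({..<2 * (3 * m)}, doubled_uniform (3 * m) (2 * m)) \<in> ?\<M>" if "m0 \<le> m" for m
    unfolding eventually_sequentially by blast
  have "(\<lambda>m. 6 * m) ` {m0..} \<subseteq> (card \<circ> fst) ` ?\<M>"
  proof
    fix k assume "k \<in> (\<lambda>m. 6 * m) ` {m0..}"
    then obtain m where "m0 \<le> m" "k = 6 * m" by auto
    then show "k \<in> (card \<circ> fst) ` ?\<M>" by (intro image_eqI[OF _ m0[of m]]) auto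
  qed
  moreover have "infinite ((\<lambda>m::nat. 6 * m) ` {m0..})"
    by (simp add: finite_image_iff inj_on_def infinite_Ici)
  ultimately show "infinite ((card \<circ> fst) ` ?\<M>)" by (rule infinite_super)
qed

end
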